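(* Let $k>1$ and $M\ge 1$ be integers, and consider the channel with parameters $(k,M,\xi,\gamma)$ where $\xi=1$ and $\gamma=\infty$. Then the code $$\mathcal{C}^*_{1,\infty}=\{\mathbf{x}\in\mathcal{X}:\ \gcd(x_1,\ldots,x_k)=1\}$$ is an optimal zero-error code for this channel. That is, any two distinct elements of $\mathcal{C}^*_{1,\infty}$ are distinguishable, and every zero-error code $\mathcal{C}\subseteq\mathcal{X}$ satisfies $|\mathcal{C}|\le|\mathcal{C}^*_{1,\infty}|$.
   Context: Input vectors: for positive integers $k,M$, let $\mathcal{X}$ be the set of vectors $\mathbf{x}=(x_1,\ldots,x_k)$ with $x_i\in\{1,\ldots,M\}$ and $\sum_{i=1}^k x_i\le M$. Channel: fix real numbers $0<a\le b<\infty$ (jitter interval $[a,b]$) with $\xi=b/a$, and a clock drift interval $I$. Either $I=[T_1,T_2]$ with $0<T_1\le T_2<\infty$ and $\gamma=T_2/T_1$, or $I=[T_1,\infty)$ with $T_1>0$, in which case $\gamma=\infty$. When $\mathbf{x}$ is sent, the output is $Y_i=TZ_ix_i$ for $i=1,\ldots,k$, where $T\in I$ and $Z_1,\ldots,Z_k\in[a,b]$ are arbitrary unknown reals. The case $\xi=1$ means no jitter ($a=b$). Two vectors $\mathbf{x},\mathbf{x}'\in\mathcal{X}$ are indistinguishable if there exist $T,T'\in I$ and $Z_1,\ldots,Z_k,Z_1',\ldots,Z_k'\in[a,b]$ such that $TZ_ix_i=T'Z_i'x_i'$ for all $i=1,\ldots,k$. Otherwise they are distinguishable. Distinguishability depends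 on the intervals only through $\xi$ and $\gamma$. A zero-error code is a set $\mathcal{C}\subseteq\mathcal{X}$ any two distinct elements of which are distinguishable. An optimal zero-error code is a zero-error code of maximum cardinality. *)

theory Defs
  imports Complex_Main "HOL-Library.Extended_Real"
begin

text \<open>Vectors \<open>(x\<^sub>1, \<dots>, x\<^sub>k)\<close> are lists of length \<open>k\<close>, indexed from 0.\<close>

definition inputs :: "nat \<Rightarrow> nat \<Rightarrow> nat list set" where
  "inputs k M = {x. length x = k \<and> set x \<subseteq> {1..M} \<and> sum_list x \<le> M}"

lemma finite_inputs: "finite (inputs k M)"
proof (rule finite_subset)
  show "inputs k M \<subseteq> {x. set x \<subseteq> {1..M} \<and> length x = k}"
    by (auto simp: inputs_def)
  show "finite {x. set x \<subseteq> {1..M} \<and> length x = k}"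
    by (rule finite_lists_length_eq) simp
qed

definition jitter_interval :: "real \<Rightarrow> real \<Rightarrow> real \<Rightarrow> bool" where
  "jitter_interval a b \<xi> \<longleftrightarrow> 0 < a \<and> a \<le> b \<and> \<xi> = b / a"

definition drift_interval :: "real set \<Rightarrow> ereal \<Rightarrow> bool" where
  "drift_interval I \<gamma> \<longleftrightarrow>
     (\<exists>T1 T2. 0 < T1 \<and> T1 \<le> T2 \<and> I = {T1..T2} \<and> \<gamma> = ereal (T2 / T1)) \<or>
     (\<exists>T1. 0 < T1 \<and> I = {T1..} \<and> \<gamma> = \<infinity>)"

definition channel_output :: "real \<Rightarrow> real list \<Rightarrow> nat list \<Rightarrow> real list" where
  "channel_output T Z x = map2 (\<lambda>z n. T * z * real n) Z x"

definition indistinguishable ::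
  "real \<Rightarrow> real \<Rightarrow> real set \<Rightarrow> nat list \<Rightarrow> nat list \<Rightarrow> bool" where
  "indistinguishable a b I x x' \<longleftrightarrow>
     (\<exists>T\<in>I. \<exists>T'\<in>I. \<exists>Z Z'.
        length Z = length x \<and> set Z \<subseteq> {a..b} \<and>
        length Z' = length x' \<and> set Z' \<subseteq> {a..b} \<and>
        channel_output T Z x = channel_output T' Z' x')"

definition zero_error_code ::
  "nat \<Rightarrow> nat \<Rightarrow> real \<Rightarrow> real \<Rightarrow> real set \<Rightarrow> nat list set \<Rightarrow> bool" where
  "zero_error_code k M a b I C \<longleftrightarrow>
     C \<subseteq> inputs k M \<and>
     (\<forall>x\<in>C. \<forall>x'\<in>C. x \<noteq> x' \<longrightarrow> \<not> indistinguishable a b I x x')"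

text \<open>Comparing codes by \<^const>\<open>card\<close> is meaningful because \<^term>\<open>inputs k M\<close> is finite.\<close>

definition optimal_zero_error_code ::
  "nat \<Rightarrow> nat \<Rightarrow> real \<Rightarrow> real \<Rightarrow> real set \<Rightarrow> nat list set \<Rightarrow> bool" where
  "optimal_zero_error_code k M a b I C \<longleftrightarrow>
     zero_error_code k M a b I C \<and>
     (\<forall>C'. zero_error_code k M a b I C' \<longrightarrow> card C' \<le> card C)"

end

(* Without jitter, an unbounded drift interval identifies exactly the positive proportional
   vectors. Each proportionality class of positive integer vectors contains exactly one
   primitive vector, and dividing by the gcd does not increase the coordinate sum; so the
   primitive vectors form a system of representatives of the classes meeting the input set. *)
theory Submission
  imports Defs
begin

lemma channel_output_replicate:
  "channel_output T (replicate (length x) a) x = map (\<lambda>n. T * a * real n) x"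
  unfolding channel_output_def by (induction x) auto

text \<open>The one-point interval \<open>{a..a}\<close> forces every \<open>Z\<close> to be
  constantly \<open>a\<close>, and this common nonzero factor cancels from both outputs. Only the
  drifts remain.\<close>

lemma indistinguishable_no_jitter:
  assumes "a \<noteq> 0"
  shows "indistinguishable a a I x x' \<longleftrightarrow>
    (\<exists>T\<in>I. \<exists>T'\<in>I. map (\<lambda>n. T * real n) x = map (\<lambda>n. T' * real n) x')"
proof -
  have const: "length Z = n \<and> set Z \<subseteq> {a..a} \<longleftrightarrow> Z = replicate n a" for Z :: "real list" and n
    by (auto intro: replicate_eqI)
  have scale: "map (\<lambda>n. T * a * real n) x = map (\<lambda>n. T' * a * real n) x' \<longleftrightarrow>
      map (\<lambda>n. T * real n) x = map (\<lambda>n. T' * real n) x'" for T T'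
    using assms by (auto simp: list_eq_iff_nth_eq)
  have "indistinguishable a a I x x' \<longleftrightarrow> (\<exists>T\<in>I. \<exists>T'\<in>I. \<exists>Z Z'.
      (length Z = length x \<and> set Z \<subseteq> {a..a}) \<and> (length Z' = length x' \<and> set Z' \<subseteq> {a..a}) \<and>
      channel_output T Z x = channel_output T' Z' x')"
    unfolding indistinguishable_def by (simp only: conj_assoc)
  also have "\<dots> \<longleftrightarrow>
    (\<exists>T\<in>I. \<exists>T'\<in>I. map (\<lambda>n. T * real n) x = map (\<lambda>n. T' * real n) x')"
    unfolding const by (simp add: channel_output_replicate scale)
  finally show ?thesis .
qed

lemma proportional_coprime_imp_eq:
  fixes x y :: "nat list" and T T' :: real
  assumes proportional: "map (\<lambda>n. T * real n) x = map (\<lambda>n. T' * real n) y"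
    and "T > 0" "T' > 0" and coprime: "Gcd (set x) = 1" "Gcd (set y) = 1"
  shows "x = y"
proof (rule nth_equalityI)
  show len: "length x = length y"
    using map_eq_imp_length_eq[OF proportional] .
  have nth: "T * real (x ! i) = T' * real (y ! i)" if "i < length x" for i
    using proportional len that by (simp add: list_eq_iff_nth_eq)
  fix i assume i: "i < length x"
  \<comment> \<open>Using the proportionality at \<open>i\<close> and at \<open>j\<close> in
    opposite directions makes \<open>T * T'\<close> a common factor. Cancelling it leaves an
    identity between naturals.\<close>
  have cross: "x ! i * y ! j = y ! i * x ! j" if "j < length x" for j
  proof -
    have "T * T' * (real (x ! i) * real (y ! j)) = (T * real (x ! i)) * (T' * real (y ! j))"
      by simp
    also have "\<dots> = (T' * real (y ! i)) * (T * real (x ! j))"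
      by (simp only: nth[OF i] nth[OF that])
    also have "\<dots> = T * T' * (real (y ! i) * real (x ! j))"
      by simp
    finally have "real (x ! i * y ! j) = real (y ! i * x ! j)"
      using \<open>T > 0\<close> \<open>T' > 0\<close> by simp
    then show ?thesis
      by (simp only: of_nat_eq_iff)
  qed
  \<comment> \<open>With \<open>i\<close> fixed and \<open>j\<close> varying, the cross identities
    equate a multiple of \<open>y\<close> with a multiple of \<open>x\<close>. Taking gcds, each
    equal to 1 up to its multiplier, equates the multipliers.\<close>
  have "map ((*) (x ! i)) y = map ((*) (y ! i)) x"
    using cross len by (simp add: list_eq_iff_nth_eq)
  then have "(*) (x ! i) ` set y = (*) (y ! i) ` set x"
    by (metis set_map)
  then have "x ! i * Gcd (set y) = y ! i * Gcd (set x)"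
    by (metis Gcd_mult normalize_nat_def id_apply)
  then show "x ! i = y ! i"
    using coprime by simp
qed

definition primitive_part :: "nat list \<Rightarrow> nat list" where
  "primitive_part x = map (\<lambda>n. n div Gcd (set x)) x"

text \<open>The division is exact because the gcd divides every entry. If the gcd is 0, all entries
  are 0 and the identity still holds.\<close>

lemma map_mult_primitive_part: "map ((*) (Gcd (set x))) (primitive_part x) = x"
  by (simp add: primitive_part_def o_def map_idI)

text \<open>The bound \<open>k > 0\<close> supplies a positive entry, which 0 cannot divide; the
  empty list would have gcd 0.\<close>

lemma Gcd_pos_inputs:
  assumes "x \<in> inputs k M" "k > 0"
  shows "Gcd (set x) > 0"
proof -
  from assms have "x \<noteq> []" "set x \<subseteq> {1..M}"
    by (auto simp: inputs_def)
  then have "hd x \<in> set x" "hd x > 0"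
    using hd_in_set[of x] by fastforce+
  then show ?thesis
    by (metis Gcd_dvd dvd_0_left gr0I less_irrefl)
qed

lemma primitive_part_inputs:
  assumes "x \<in> inputs k M" "k > 0"
  shows "primitive_part x \<in> {y \<in> inputs k M. Gcd (set y) = 1}"
proof -
  let ?g = "Gcd (set x)"
  have g: "?g > 0"
    using Gcd_pos_inputs[OF assms] .
  have "n div ?g \<in> {1..M}" if "n \<in> set x" for n
  proof -
    have "n \<in> {1..M}"
      using assms that by (auto simp: inputs_def)
    moreover have "?g dvd n"
      using that by (rule Gcd_dvd)
    ultimately show ?thesis
      using g by (auto simp: Suc_le_eq div_greater_zero_iff dvd_imp_le
          intro: order_trans[OF div_le_dividend])
  qed
  moreover have "sum_list (primitive_part x) \<le> sum_list x"
    using sum_list_mono[of x "\<lambda>n. n div ?g" "\<lambda>n. n"] by (simp add: primitive_part_def)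
  ultimately have "primitive_part x \<in> inputs k M"
    using assms by (auto simp: inputs_def primitive_part_def)
  \<comment> \<open>Take gcds on both sides of \<open>map_mult_primitive_part\<close>; cancelling
    \<open>?g > 0\<close> then gives gcd 1.\<close>
  moreover have "?g * Gcd (set (primitive_part x)) = ?g"
    by (metis Gcd_mult map_mult_primitive_part normalize_nat_def id_apply set_map)
  ultimately show ?thesis
    using g by (simp del: Gcd_0_iff)
qed

text \<open>If x = g p and y = h p, then drift T h on x and drift T g on y both produce T g h p.
  Both drifts are admissible since g, h \<ge> 1 and the interval has no upper end.\<close>

lemma indistinguishable_if_primitive_part_eq:
  assumes "x \<in> inputs k M" "y \<in> inputs k M" "k > 0" "a \<noteq> 0" "T > 0"
    and eq: "primitive_part x = primitive_part y"
  shows "indistinguishable a a {T..} x y"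
proof -
  let ?g = "\<lambda>x. Gcd (set x :: nat set)"
  have "?g x \<ge> 1" "?g y \<ge> 1"
    using Gcd_pos_inputs assms(1-3) by (simp_all add: Suc_le_eq)
  then have "T * ?g y \<in> {T..}" "T * ?g x \<in> {T..}"
    using \<open>T > 0\<close> by auto
  moreover have "map (\<lambda>n. T * ?g y * real n) x = map (\<lambda>n. T * ?g x * real n) y"
  proof -
    have "map (\<lambda>n. T * ?g y * real n) x
        = map (\<lambda>n. T * ?g y * real n) (map ((*) (?g x)) (primitive_part x))"
      by (simp only: map_mult_primitive_part)
    also have "\<dots> = map (\<lambda>n. T * ?g x * real n) (map ((*) (?g y)) (primitive_part y))"
      by (simp add: eq mult_ac)
    finally show ?thesis
      by (simp only: map_mult_primitive_part)
  qed
  ultimately show ?thesis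
    unfolding indistinguishable_no_jitter[OF \<open>a \<noteq> 0\<close>] by blast
qed

theorem theorem1:
  fixes k M :: nat and a b :: real and I :: "real set"
  assumes "k > 1" and "M \<ge> 1"
    and "jitter_interval a b 1"
    and "drift_interval I \<infinity>"
  shows "optimal_zero_error_code k M a b I {x \<in> inputs k M. Gcd (set x) = 1}"
proof -
  let ?P = "{x \<in> inputs k M. Gcd (set x) = 1}"
  from assms(3) have a: "a \<noteq> 0" and b: "b = a"
    by (auto simp: jitter_interval_def)
  from assms(4) obtain T1 where T1: "T1 > 0" and I: "I = {T1..}"
    by (auto simp: drift_interval_def)
  \<comment> \<open>All drifts in \<open>I\<close> are at least \<open>T1 > 0\<close>, so
    indistinguishable vectors in \<open>?P\<close> are positively proportional and hence
    equal.\<close>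
  have "zero_error_code k M a b I ?P"
    unfolding zero_error_code_def b I indistinguishable_no_jitter[OF a]
    using T1 by (auto dest!: proportional_coprime_imp_eq)
  \<comment> \<open>\<open>primitive_part\<close> injects \<open>C\<close> into \<open>?P\<close>:
    two distinct codewords with the same image would be indistinguishable.\<close>
  moreover have "card C \<le> card ?P" if C: "zero_error_code k M a b I C" for C
  proof (rule card_inj_on_le)
    show "inj_on primitive_part C"
    proof (rule inj_onI, rule ccontr)
      fix x y assume xy: "x \<in> C" "y \<in> C" "primitive_part x = primitive_part y" "x \<noteq> y"
      then have "indistinguishable a b I x y"
        unfolding b I using C a T1 \<open>k > 1\<close>
        by (intro indistinguishable_if_primitive_part_eq) (auto simp: zero_error_code_def)
      with C xy show False
        by (auto simp: zero_error_code_def)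
    qed
    show "primitive_part ` C \<subseteq> ?P"
      using C \<open>k > 1\<close> primitive_part_inputs by (fastforce simp: zero_error_code_def)
    show "finite ?P"
      using finite_inputs by simp
  qed
  ultimately show ?thesis
    by (simp add: optimal_zero_error_code_def)
qed

end
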